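(* Consider the lossless quadratic system $\dot x(t) = c + Lx(t) + f(x(t))$ on $\mathbb{R}^n$, with $c\in\mathbb{R}^n$, $L\in\mathbb{R}^{n\times n}$, $f_i(x)=x^\top Q^{(i)}x$ with $Q^{(i)}\in\mathbb{R}^{n\times n}$ symmetric for $i=1,\dots,n$, and $x^\top f(x)=0$ for all $x\in\mathbb{R}^n$. Let $A_s(m)$, $d(m)$, $K_m$, $B(m,R)$ and "monotonically attracting trapping region" be as defined in the context. Let $$a^* = \inf\{\, a\in\mathbb{R} \;:\; \exists\, m\in\mathbb{R}^n \text{ with } A_s(m)\preceq a I_n \,\},$$ and for $m\in\mathbb{R}^n$ let $R_m^*\in[0,\infty]$ be given by $$(R_m^* )^2 = \sup\{\, y^\top y \;:\; y\in\mathbb{R}^n,\ d(m)^\top y + y^\top A_s(m) y \ge 0 \,\}.$$ Then: (1) There exists $m\in\mathbb{R}^n$ such that $R_m^*<\infty$ and $B(m,R_m^* )$ is a monotonically attracting trapping region of the system if and only if $a^*<0$. (2) If $a^*<0$, then there exists at least one $m\in\mathbb{R}^n$ such that $A_s(m)\prec 0$. For any such $m$, the tightest monotonically attracting trapping region centered at $m$ is $B(m,R_m^* )$; that is, $R_m^*<\infty$, $B(m,R_m^* )$ is a monotonically attracting trapping region, and $R_m^*$ is the smallest $R\ge 0$ for which $B(m,R)$ is a monotonically attracting trapping region.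
   Context: Notation: $\|\cdot\|$ is the Euclidean norm; for symmetric matrices $\prec,\preceq$ denote the Loewner (definiteness) order; $I_n$ is the identity. $L_s=\frac12(L+L^\top)$. For $m\in\mathbb{R}^n$ define $d(m)=c+Lm+f(m)$ and $$A_s(m)=L_s-\sum_{k=1}^n m_k Q^{(k)}.$$ In shifted coordinates $y=x-m$ the system becomes $\dot y = d(m)+A(m)y+f(y)$, where $A(m)$ is the sum of $L$ and the matrix whose $i$-th row is $2m^\top Q^{(i)}$; by the lossless property $A_s(m)$ is the symmetric part of $A(m)$. The shifted kinetic energy is $K_m(y)=\frac12\|y\|^2$; along trajectories its time derivative is $\frac{d}{dt}K_m(y(t)) = d(m)^\top y(t)+y(t)^\top A_s(m)y(t)$. $B(v,R)=\{x\in\mathbb{R}^n:\|x-v\|\le R\}$ is the closed ball. A trapping region is a compact set $D\subseteq\mathbb{R}^n$ that is forward invariant: if $x(t_0)\in D$ then $x(t)\in D$ for all $t\ge t_0$. A ball $D=B(m,R)$ is a (globally) monotonically attracting trapping region if it is a trapping region and the energy $\frac12\|x-m\|^2$ is strictly decreasing outside $D$, meaning that its time derivative along the system is strictly negative at every state $x\notin B(m,R)$; equivalently, $d(m)^\top y+y^\top A_s(m)y<0$ for all $y\in\mathbb{R}^n$ with $\|y\|>R$. *)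

theory Defs
  imports "HOL-Analysis.Analysis"
begin

text \<open>Loewner order on real symmetric matrices.\<close>

definition pos_semidef :: "real^'n^'n \<Rightarrow> bool" where
  "pos_semidef M \<longleftrightarrow> transpose M = M \<and> (\<forall>x. 0 \<le> x \<bullet> (M *v x))"

definition pos_def :: "real^'n^'n \<Rightarrow> bool" where
  "pos_def M \<longleftrightarrow> transpose M = M \<and> (\<forall>x. x \<noteq> 0 \<longrightarrow> 0 < x \<bullet> (M *v x))"

definition loewner_le :: "real^'n^'n \<Rightarrow> real^'n^'n \<Rightarrow> bool"  (infix "\<preceq>" 50) where
  "A \<preceq> B \<longleftrightarrow> pos_semidef (B - A)"

definition loewner_less :: "real^'n^'n \<Rightarrow> real^'n^'n \<Rightarrow> bool"  (infix "\<prec>" 50) where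
  "A \<prec> B \<longleftrightarrow> pos_def (B - A)"

definition quad :: "('n \<Rightarrow> real^'n^'n) \<Rightarrow> real^'n \<Rightarrow> real^'n" where
  "quad Q x = (\<chi> i. x \<bullet> (Q i *v x))"

definition vfield :: "real^'n \<Rightarrow> real^'n^'n \<Rightarrow> ('n \<Rightarrow> real^'n^'n) \<Rightarrow> real^'n \<Rightarrow> real^'n" where
  "vfield c L Q x = c + L *v x + quad Q x"

definition lossless :: "('n \<Rightarrow> real^'n^'n) \<Rightarrow> bool" where
  "lossless Q \<longleftrightarrow> (\<forall>x. x \<bullet> quad Q x = 0)"

definition sym_part :: "real^'n^'n \<Rightarrow> real^'n^'n" where
  "sym_part L = (1/2) *\<^sub>R (L + transpose L)"

definition d_shift :: "real^'n \<Rightarrow> real^'n^'n \<Rightarrow> ('n \<Rightarrow> real^'n^'n) \<Rightarrow> real^'n \<Rightarrow> real^'n" where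
  "d_shift c L Q m = c + L *v m + quad Q m"

definition A_s :: "real^'n^'n \<Rightarrow> ('n \<Rightarrow> real^'n^'n) \<Rightarrow> real^'n \<Rightarrow> real^'n^'n" where
  "A_s L Q m = sym_part L - (\<Sum>k\<in>UNIV. (m $ k) *\<^sub>R Q k)"

text \<open>Solutions are taken on compact time intervals, with one-sided derivatives at the
  end points. Restricting a solution on a longer interval shows that
  \<open>forward_invariant\<close> covers trajectories on every interval \<open>[t0,T)\<close>, including \<open>[t0,\<infinity>)\<close>.\<close>

definition solves :: "(real^'n \<Rightarrow> real^'n) \<Rightarrow> (real \<Rightarrow> real^'n) \<Rightarrow> real \<Rightarrow> real \<Rightarrow> bool" where
  "solves F x t0 T \<longleftrightarrow>
     (\<forall>t\<in>{t0..T}. (x has_vector_derivative F (x t)) (at t within {t0..T}))"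

definition forward_invariant :: "(real^'n \<Rightarrow> real^'n) \<Rightarrow> (real^'n) set \<Rightarrow> bool" where
  "forward_invariant F D \<longleftrightarrow>
     (\<forall>x t0 T. solves F x t0 T \<longrightarrow> x t0 \<in> D \<longrightarrow> (\<forall>t\<in>{t0..T}. x t \<in> D))"

definition trapping_region :: "(real^'n \<Rightarrow> real^'n) \<Rightarrow> (real^'n) set \<Rightarrow> bool" where
  "trapping_region F D \<longleftrightarrow> compact D \<and> forward_invariant F D"

definition kinetic_energy :: "real^'n \<Rightarrow> real" where
  "kinetic_energy y = (norm y)\<^sup>2 / 2"

text \<open>\<open>rate F V x\<close> is the time derivative of \<open>V\<close> along \<open>x' = F x\<close> at the state \<open>x\<close>
  (for \<open>V\<close> differentiable at \<open>x\<close>).\<close>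

definition rate :: "(real^'n \<Rightarrow> real^'n) \<Rightarrow> (real^'n \<Rightarrow> real) \<Rightarrow> real^'n \<Rightarrow> real" where
  "rate F V x = frechet_derivative V (at x) (F x)"

definition mono_attracting_trapping ::
  "(real^'n \<Rightarrow> real^'n) \<Rightarrow> real^'n \<Rightarrow> real \<Rightarrow> bool" where
  "mono_attracting_trapping F m R \<longleftrightarrow>
     trapping_region F (cball m R) \<and>
     (\<forall>x. x \<notin> cball m R \<longrightarrow> rate F (\<lambda>z. kinetic_energy (z - m)) x < 0)"

definition a_star :: "real^'n^'n \<Rightarrow> ('n \<Rightarrow> real^'n^'n) \<Rightarrow> ereal" where
  "a_star L Q = (INF a\<in>{a::real. \<exists>m. A_s L Q m \<preceq> a *\<^sub>R mat 1}. ereal a)"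

definition R_star_sq :: "real^'n \<Rightarrow> real^'n^'n \<Rightarrow> ('n \<Rightarrow> real^'n^'n) \<Rightarrow> real^'n \<Rightarrow> ereal" where
  "R_star_sq c L Q m =
     (SUP y\<in>{y. d_shift c L Q m \<bullet> y + y \<bullet> (A_s L Q m *v y) \<ge> 0}. ereal (y \<bullet> y))"

definition R_star :: "real^'n \<Rightarrow> real^'n^'n \<Rightarrow> ('n \<Rightarrow> real^'n^'n) \<Rightarrow> real^'n \<Rightarrow> ereal" where
  "R_star c L Q m =
     (if R_star_sq c L Q m = \<infinity> then \<infinity> else ereal (sqrt (real_of_ereal (R_star_sq c L Q m))))"

lemma R_star_sq_nonneg:
  fixes c :: "real^'n"
  shows "0 \<le> R_star_sq c L Q m"
proof -
  have "ereal ((0::real^'n) \<bullet> 0) \<le> R_star_sq c L Q m"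
    unfolding R_star_sq_def by (rule SUP_upper) simp
  then show ?thesis by (simp add: zero_ereal_def)
qed

lemma R_star_nonneg: "0 \<le> R_star c L Q m"
  using R_star_sq_nonneg[of c L Q m]
  by (simp add: R_star_def real_of_ereal_pos)

lemma R_star_power2: "(R_star c L Q m)\<^sup>2 = R_star_sq c L Q m"
  using R_star_sq_nonneg[of c L Q m]
  by (cases "R_star_sq c L Q m") (auto simp: R_star_def power2_eq_square)

end

theory Submission
  imports Defs
begin

text \<open>Everything rests on one identity: along the system, the energy
  \<open>\<parallel>x - m\<parallel>\<^sup>2 / 2\<close> changes at the rate \<open>E y = d(m) \<bullet> y + y \<bullet> A\<^sub>s(m) y\<close>, where \<open>y = x - m\<close>
  (\<open>rate_kinetic_energy\<close>). Losslessness removes the cubic terms, so that this rate is an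
  inhomogeneous quadratic polynomial in \<open>y\<close>, and the quadratic contributions of \<open>f\<close> are moved into
  \<open>A\<^sub>s(m)\<close> by polarisation (\<open>lossless_polarization\<close>). By definition \<open>R\<^sub>m\<^sup>*\<close> is the radius of the
  smallest ball around the origin containing \<open>{y. E y \<ge> 0}\<close>.

  That set is bounded exactly when \<open>A\<^sub>s(m)\<close> is negative definite. If it is, compactness of the unit
  sphere gives \<open>y \<bullet> A\<^sub>s(m) y \<le> - e \<parallel>y\<parallel>\<^sup>2\<close> with \<open>e > 0\<close>, which dominates the linear term for large
  \<open>y\<close>. If it is not, some \<open>v \<noteq> 0\<close> has \<open>v \<bullet> A\<^sub>s(m) v \<ge> 0\<close>, and \<open>E\<close> is nonnegative on the
  ray through \<open>v\<close> or the one through \<open>- v\<close>, according to the sign of \<open>d(m) \<bullet> v\<close>. The same uniform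
  bound shows that some \<open>A\<^sub>s(m)\<close> is negative definite if and only if \<open>a\<^sup>* < 0\<close>.

  A ball outside which the energy decreases is forward invariant, because a trajectory
  that has left it would have gained energy since it last met the ball
  (\<open>forward_invariant_cball\<close>). Hence \<open>B(m, R)\<close> is monotonically attracting if and only if \<open>E\<close> is
  negative beyond radius \<open>R\<close>, that is, if and only if \<open>R\<^sub>m\<^sup>* \<le> R\<close>
  (\<open>mono_attracting_trapping_iff_R_star_le\<close>). Both parts of the theorem follow.\<close>

section \<open>The energy rate in shifted coordinates\<close>

lemma inner_transpose_matrix_vector:
  fixes M :: "real^'n^'n"
  shows "x \<bullet> (transpose M *v y) = y \<bullet> (M *v x)"
  by (metis dot_lmul_matrix inner_commute transpose_matrix_vector)

lemma inner_sym_part: "y \<bullet> (sym_part L *v y) = y \<bullet> (L *v y)"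
  by (simp add: sym_part_def scaleR_matrix_vector_assoc[symmetric] matrix_vector_mult_add_rdistrib
      inner_add_right inner_transpose_matrix_vector del: transpose_matrix_vector)

lemma transpose_sum: "transpose (\<Sum>k\<in>S. M k) = (\<Sum>k\<in>S. transpose (M k))"
  by (simp add: transpose_def vec_eq_iff sum_component)

lemma transpose_A_s:
  assumes "\<And>i. transpose (Q i) = Q i"
  shows "transpose (A_s L Q m) = A_s L Q m"
proof -
  have "transpose (sym_part L) = sym_part L"
    by (simp add: sym_part_def transpose_def vec_eq_iff add.commute)
  moreover have "transpose (\<Sum>k\<in>UNIV. (m $ k) *\<^sub>R Q k) = (\<Sum>k\<in>UNIV. (m $ k) *\<^sub>R Q k)"
    by (simp add: transpose_sum transpose_scalar assms)
  ultimately show ?thesis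
    by (simp add: A_s_def transpose_def vec_eq_iff)
qed

lemma sum_matrix_vector_mult:
  fixes M :: "'k \<Rightarrow> real^'n^'m"
  shows "(\<Sum>k\<in>S. M k) *v y = (\<Sum>k\<in>S. M k *v y)"
  by (induction S rule: infinite_finite_induct) (simp_all add: matrix_vector_mult_add_rdistrib)

lemma inner_A_s:
  "y \<bullet> (A_s L Q m *v y) = y \<bullet> (L *v y) - m \<bullet> quad Q y"
proof -
  have "y \<bullet> ((\<Sum>k\<in>UNIV. (m $ k) *\<^sub>R Q k) *v y) = m \<bullet> quad Q y"
    by (simp add: sum_matrix_vector_mult inner_sum_right scaleR_matrix_vector_assoc[symmetric]
        quad_def inner_vec_def[of m])
  then show ?thesis
    by (simp add: A_s_def matrix_vector_mult_diff_rdistrib inner_diff_right inner_sym_part)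
qed

lemma quad_add:
  assumes "\<And>i. transpose (Q i) = Q i"
  shows "quad Q (x + y) = quad Q x + quad Q y + 2 *\<^sub>R (\<chi> i. x \<bullet> (Q i *v y))"
proof -
  have "y \<bullet> (Q i *v x) = x \<bullet> (Q i *v y)" for i
    using inner_transpose_matrix_vector[of x "Q i" y] by (simp add: assms)
  then show ?thesis
    by (simp add: quad_def vec_eq_iff matrix_vector_right_distrib inner_add_left inner_add_right)
qed

lemma matrix_vector_mult_minus: "M *v (- x) = - (M *v x)" for M :: "real^'n^'m"
  using matrix_vector_mult_scaleR[of M "- 1" x] by simp

lemma quad_minus: "quad Q (- x) = quad Q x"
  by (simp add: quad_def vec_eq_iff matrix_vector_mult_minus)

text \<open>The cubic form \<open>x \<bullet> f(x)\<close> vanishes on \<open>y + m\<close> and on \<open>y - m\<close>; subtracting the two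
  expansions leaves the part that is odd in \<open>m\<close>. Of this, the cubic term \<open>m \<bullet> f(m)\<close> vanishes
  as well, and the term linear in \<open>m\<close> gives the claim.\<close>

lemma lossless_polarization:
  assumes sym: "\<And>i. transpose (Q i) = Q i" and "lossless Q"
  shows "2 * (y \<bullet> (\<chi> i. m \<bullet> (Q i *v y))) = - (m \<bullet> quad Q y)"
proof -
  define b where "b = (\<chi> i. m \<bullet> (Q i *v y))"
  have null: "x \<bullet> quad Q x = 0" for x
    using \<open>lossless Q\<close> by (simp add: lossless_def)
  have plus: "quad Q (m + y) = quad Q m + quad Q y + 2 *\<^sub>R b"
    by (simp add: quad_add[of Q, OF sym] b_def)
  have "(\<chi> i. (- m) \<bullet> (Q i *v y)) = - b"
    by (simp add: b_def vec_eq_iff)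
  then have minus: "quad Q (- m + y) = quad Q m + quad Q y - 2 *\<^sub>R b"
    using quad_add[of Q, OF sym, of "- m" y] by (simp add: quad_minus)
  have "(m + y) \<bullet> quad Q (m + y) = 0" "(- m + y) \<bullet> quad Q (- m + y) = 0"
    by (rule null)+
  then show ?thesis
    unfolding plus minus b_def[symmetric]
    using null[of m] null[of y]
    by (simp add: inner_add_left inner_add_right inner_diff_right inner_diff_left)
qed

lemma inner_vfield_shift:
  assumes sym: "\<And>i. transpose (Q i) = Q i" and "lossless Q"
  shows "y \<bullet> vfield c L Q (m + y) = d_shift c L Q m \<bullet> y + y \<bullet> (A_s L Q m *v y)"
proof -
  have "y \<bullet> quad Q y = 0"
    using \<open>lossless Q\<close> by (simp add: lossless_def)
  then show ?thesis
    using lossless_polarization[of Q, OF assms, of y m]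
    by (simp add: vfield_def d_shift_def inner_A_s quad_add[of Q, OF sym] matrix_vector_right_distrib
        inner_add_right inner_commute[of _ y])
qed

lemma rate_kinetic_energy_eq_inner:
  "rate F (\<lambda>z. kinetic_energy (z - m)) x = (x - m) \<bullet> F x"
proof -
  have "((\<lambda>z. kinetic_energy (z - m)) has_derivative (\<lambda>h. (x - m) \<bullet> h)) (at x)"
    unfolding kinetic_energy_def power2_norm_eq_inner
    by (auto intro!: derivative_eq_intros simp: inner_commute)
  then show ?thesis
    by (simp add: rate_def frechet_derivative_at[symmetric])
qed

lemma rate_kinetic_energy:
  assumes "\<And>i. transpose (Q i) = Q i" and "lossless Q"
  shows "rate (vfield c L Q) (\<lambda>z. kinetic_energy (z - m)) x
    = d_shift c L Q m \<bullet> (x - m) + (x - m) \<bullet> (A_s L Q m *v (x - m))"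
  using inner_vfield_shift[of Q, OF assms, of "x - m" c L m]
  by (simp add: rate_kinetic_energy_eq_inner)

section \<open>Forward invariance of balls\<close>

text \<open>Let the trajectory \<open>x\<close> start in the ball, and let \<open>s\<close> be the last time before \<open>t\<close> at which the trajectory is in the ball. If \<open>x t\<close> were
  outside, the distance to the centre would decrease strictly on \<open>(s, t]\<close>, although it
  has grown from at most \<open>R\<close> to more than \<open>R\<close>.\<close>

lemma forward_invariant_cball:
  assumes "R \<ge> 0" and inward: "\<And>x. norm (x - m) > R \<Longrightarrow> (x - m) \<bullet> F x < 0"
  shows "forward_invariant F (cball m R)"
  unfolding forward_invariant_def
proof (intro allI impI ballI)
  fix x t0 T t
  assume sol: "solves F x t0 T" and start: "x t0 \<in> cball m R" and t: "t \<in> {t0..T}"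
  define V where "V = (\<lambda>s. (x s - m) \<bullet> (x s - m))"
  have V_le_iff: "V s \<le> R\<^sup>2 \<longleftrightarrow> x s \<in> cball m R" for s
    using \<open>R \<ge> 0\<close> by (simp add: V_def dist_norm norm_minus_commute[of m] norm_le_square)
  have deriv_V: "(V has_real_derivative 2 * ((x s - m) \<bullet> F (x s))) (at s within {t0..T})"
    if "s \<in> {t0..T}" for s
  proof -
    have "(x has_derivative (\<lambda>h. h *\<^sub>R F (x s))) (at s within {t0..T})"
      using sol that by (simp add: solves_def has_vector_derivative_def)
    then show ?thesis
      unfolding V_def has_field_derivative_def
      by (auto intro!: derivative_eq_intros simp: inner_commute algebra_simps)
  qed
  have cont_V: "continuous_on {t0..T} V"
    using deriv_V by (intro DERIV_continuous_on)
  show "x t \<in> cball m R"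
  proof (rule ccontr)
    assume "x t \<notin> cball m R"
    then have out: "V t > R\<^sup>2"
      using V_le_iff by (meson not_le)
    define S where "S = {t0..t} \<inter> V -` {..R\<^sup>2}"
    have "continuous_on {t0..t} V"
      using cont_V t by (auto elim: continuous_on_subset)
    then have "closed S"
      unfolding S_def by (intro continuous_closed_preimage) auto
    moreover have "bounded S"
      by (rule bounded_subset[of "{t0..t}"]) (auto simp: S_def)
    ultimately have "compact S"
      by (simp add: compact_eq_bounded_closed)
    moreover have "S \<noteq> {}"
      using start t V_le_iff[of t0] by (auto simp: S_def)
    ultimately obtain s where s: "s \<in> S" and last: "\<And>r. r \<in> S \<Longrightarrow> r \<le> s"
      using compact_attains_sup by metis
    have "s < t"
      using s out by (auto simp: S_def less_le)
    have "V t < V s"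
    proof (rule DERIV_neg_imp_decreasing_open[OF \<open>s < t\<close>])
      fix r assume r: "s < r" "r < t"
      then have "r \<in> {t0<..<T}" using s t by (auto simp: S_def)
      then have "(V has_real_derivative 2 * ((x r - m) \<bullet> F (x r))) (at r)"
        using deriv_V[of r] by (simp add: at_within_Icc_at)
      moreover have "r \<notin> S"
        using last r by force
      then have "x r \<notin> cball m R"
        using r s by (simp add: S_def V_le_iff)
      then have "(x r - m) \<bullet> F (x r) < 0"
        by (intro inward) (simp add: dist_norm norm_minus_commute)
      ultimately show "\<exists>D. (V has_real_derivative D) (at r) \<and> D < 0"
        by (intro exI[of _ "2 * ((x r - m) \<bullet> F (x r))"]) simp
    next
      show "continuous_on {s..t} V"
        using cont_V s t by (auto simp: S_def elim: continuous_on_subset)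
    qed
    then show False
      using s out by (simp add: S_def)
  qed
qed

section \<open>Boundedness of the set where the energy does not decrease\<close>

lemma negative_form_uniform_bound:
  fixes M :: "real^'n^'n"
  assumes neg: "\<And>x. x \<noteq> 0 \<Longrightarrow> x \<bullet> (M *v x) < 0"
  obtains e where "e > 0" "\<And>x. x \<bullet> (M *v x) \<le> - e * (x \<bullet> x)"
proof -
  have cont: "continuous_on (sphere 0 1) (\<lambda>x. x \<bullet> (M *v x))"
    by (intro continuous_intros)
  have nonempty: "sphere (0::real^'n) 1 \<noteq> {}" by simp
  obtain u where u: "u \<in> sphere 0 1"
    and max: "\<And>x. x \<in> sphere 0 1 \<Longrightarrow> x \<bullet> (M *v x) \<le> u \<bullet> (M *v u)"
    using continuous_attains_sup[OF compact_sphere nonempty cont] by blast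
  show thesis
  proof
    show "- (u \<bullet> (M *v u)) > 0"
      using neg[of u] u by (cases "u = 0") auto
    fix x :: "real^'n"
    show "x \<bullet> (M *v x) \<le> - (- (u \<bullet> (M *v u))) * (x \<bullet> x)"
    proof (cases "x = 0")
      case False
      define w where "w = x /\<^sub>R norm x"
      have x: "x = norm x *\<^sub>R w" and "w \<in> sphere 0 1"
        using False by (simp_all add: w_def)
      then have "w \<bullet> (M *v w) \<le> u \<bullet> (M *v u)"
        by (intro max)
      then have "(norm x)\<^sup>2 * (w \<bullet> (M *v w)) \<le> (norm x)\<^sup>2 * (u \<bullet> (M *v u))"
        by (intro mult_left_mono) auto
      moreover have "x \<bullet> (M *v x) = (norm x)\<^sup>2 * (w \<bullet> (M *v w))"
        using x by (metis inner_scaleR_left inner_scaleR_right matrix_vector_mult_scaleR mult.assoc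
            power2_eq_square)
      ultimately show ?thesis
        by (simp add: dot_square_norm mult.commute)
    qed simp
  qed
qed

lemma A_s_loewner_le_iff:
  assumes "\<And>i. transpose (Q i) = Q i"
  shows "A_s L Q m \<preceq> a *\<^sub>R mat 1 \<longleftrightarrow> (\<forall>x. x \<bullet> (A_s L Q m *v x) \<le> a * (x \<bullet> x))"
proof -
  have "transpose (a *\<^sub>R mat 1 - A_s L Q m) = a *\<^sub>R mat 1 - transpose (A_s L Q m)"
    by (simp add: transpose_def vec_eq_iff mat_def)
  then show ?thesis
    by (simp add: loewner_le_def pos_semidef_def transpose_A_s[of Q, OF assms]
        matrix_vector_mult_diff_rdistrib scaleR_matrix_vector_assoc[symmetric] inner_diff_right)
qed

lemma A_s_negative_definite_iff:
  assumes "\<And>i. transpose (Q i) = Q i"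
  shows "A_s L Q m \<prec> 0 \<longleftrightarrow> (\<forall>x. x \<noteq> 0 \<longrightarrow> x \<bullet> (A_s L Q m *v x) < 0)"
proof -
  have "transpose (0 - A_s L Q m) = 0 - transpose (A_s L Q m)"
    by (simp add: transpose_def vec_eq_iff)
  then show ?thesis
    unfolding loewner_less_def pos_def_def transpose_A_s[of Q, OF assms]
    by (simp add: matrix_vector_mult_diff_rdistrib inner_diff_right del: diff_0)
qed

lemma quadratic_superlevel_bounded:
  fixes M :: "real^'n^'n"
  assumes "\<And>x. x \<noteq> 0 \<Longrightarrow> x \<bullet> (M *v x) < 0"
  obtains C where "\<And>y. d \<bullet> y + y \<bullet> (M *v y) \<ge> 0 \<Longrightarrow> y \<bullet> y \<le> C"
proof -
  obtain e where "e > 0" and e: "\<And>x. x \<bullet> (M *v x) \<le> - e * (x \<bullet> x)"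
    using negative_form_uniform_bound[OF assms] by blast
  show thesis
  proof
    fix y assume y: "d \<bullet> y + y \<bullet> (M *v y) \<ge> 0"
    have "e * (norm y * norm y) \<le> d \<bullet> y"
      using y e[of y] by (simp add: dot_square_norm power2_eq_square)
    also have "\<dots> \<le> norm d * norm y"
      by (rule norm_cauchy_schwarz)
    finally have "norm y \<le> norm d / e"
      using \<open>e > 0\<close> by (cases "y = 0") (simp_all add: field_simps)
    then show "y \<bullet> y \<le> (norm d / e)\<^sup>2"
      by (simp add: dot_square_norm power_mono)
  qed
qed

text \<open>On the ray through \<open>v\<close>, with \<open>v\<close> oriented so that \<open>d \<bullet> v \<ge> 0\<close>, both the linear and
  the quadratic term would be nonnegative if the form were nonnegative at \<open>v\<close>.\<close>

lemma bounded_quadratic_superlevel_imp_negative: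
  fixes M :: "real^'n^'n"
  assumes bound: "\<And>y. d \<bullet> y + y \<bullet> (M *v y) \<ge> 0 \<Longrightarrow> y \<bullet> y \<le> C" and "v \<noteq> 0"
  shows "v \<bullet> (M *v v) < 0"
proof (rule ccontr)
  assume nonneg: "\<not> v \<bullet> (M *v v) < 0"
  define w where "w = (if d \<bullet> v \<ge> 0 then v else - v)"
  have w: "d \<bullet> w \<ge> 0" "w \<bullet> (M *v w) \<ge> 0" "w \<bullet> w > 0"
    using nonneg \<open>v \<noteq> 0\<close> by (auto simp: w_def matrix_vector_mult_minus)
  have scaled: "s\<^sup>2 * (w \<bullet> w) \<le> C" if "s \<ge> 0" for s
    using bound[of "s *\<^sub>R w"] w that
    by (simp add: matrix_vector_mult_scaleR power2_eq_square mult.assoc)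
  have "C \<ge> 0" using scaled[of 0] by simp
  \<comment> \<open>The scaling by which the squared length equals \<open>C + 1\<close>.\<close>
  then have "(sqrt ((C + 1) / (w \<bullet> w)))\<^sup>2 * (w \<bullet> w) = C + 1"
    using w by simp
  then show False
    using scaled[of "sqrt ((C + 1) / (w \<bullet> w))"] \<open>C \<ge> 0\<close> w by simp
qed

lemma R_star_sq_le_iff:
  "R_star_sq c L Q m \<le> ereal C \<longleftrightarrow>
    (\<forall>y. d_shift c L Q m \<bullet> y + y \<bullet> (A_s L Q m *v y) \<ge> 0 \<longrightarrow> y \<bullet> y \<le> C)"
  by (auto simp: R_star_sq_def SUP_le_iff)

lemma R_star_le_iff:
  assumes "R \<ge> 0"
  shows "R_star c L Q m \<le> ereal R \<longleftrightarrow>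
    (\<forall>y. norm y > R \<longrightarrow> d_shift c L Q m \<bullet> y + y \<bullet> (A_s L Q m *v y) < 0)"
proof -
  have "R_star c L Q m \<le> ereal R \<longleftrightarrow> R_star_sq c L Q m \<le> ereal (R\<^sup>2)"
    using R_star_sq_nonneg[of c L Q m] assms
    by (cases "R_star_sq c L Q m") (auto simp: R_star_def real_sqrt_le_iff' intro: real_le_lsqrt)
  also have "\<dots> \<longleftrightarrow> (\<forall>y. norm y > R \<longrightarrow> d_shift c L Q m \<bullet> y + y \<bullet> (A_s L Q m *v y) < 0)"
  proof -
    have "y \<bullet> y \<le> R\<^sup>2 \<longleftrightarrow> norm y \<le> R" for y :: "real^'n"
      using assms by (simp add: norm_le_square)
    then show ?thesis
      unfolding R_star_sq_le_iff by (meson not_le)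
  qed
  finally show ?thesis .
qed

lemma R_star_finite_iff_negative_definite:
  assumes sym: "\<And>i. transpose (Q i) = Q i"
  shows "R_star c L Q m < \<infinity> \<longleftrightarrow> A_s L Q m \<prec> 0"
proof -
  have "R_star c L Q m < \<infinity> \<longleftrightarrow> R_star_sq c L Q m < \<infinity>"
    by (simp add: R_star_def)
  also have "\<dots> \<longleftrightarrow> (\<exists>C. R_star_sq c L Q m \<le> ereal C)"
    using R_star_sq_nonneg[of c L Q m] by (cases "R_star_sq c L Q m") auto
  also have "\<dots> \<longleftrightarrow> (\<forall>x. x \<noteq> 0 \<longrightarrow> x \<bullet> (A_s L Q m *v x) < 0)"
    unfolding R_star_sq_le_iff
    by (metis bounded_quadratic_superlevel_imp_negative quadratic_superlevel_bounded)
  finally show ?thesis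
    by (simp add: A_s_negative_definite_iff[of Q, OF sym])
qed

section \<open>Attracting balls and negative definiteness\<close>

text \<open>The energy rate depends only on \<open>x - m\<close>, so its sign outside the ball is exactly what
  \<open>R_star\<close> measures. Invariance of the ball is then automatic, which makes minimality of
  \<open>R\<^sub>m\<^sup>*\<close> and its own attracting property two cases of the same equivalence.\<close>

lemma mono_attracting_trapping_iff_R_star_le:
  assumes "\<And>i. transpose (Q i) = Q i" and "lossless Q" and "R \<ge> 0"
  shows "mono_attracting_trapping (vfield c L Q) m R \<longleftrightarrow> R_star c L Q m \<le> ereal R"
proof -
  have "(\<forall>x. x \<notin> cball m R \<longrightarrow> rate (vfield c L Q) (\<lambda>z. kinetic_energy (z - m)) x < 0)
    \<longleftrightarrow> R_star c L Q m \<le> ereal R" (is "?decrease \<longleftrightarrow> _")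
  proof -
    have "?decrease \<longleftrightarrow>
      (\<forall>y. norm y > R \<longrightarrow> d_shift c L Q m \<bullet> y + y \<bullet> (A_s L Q m *v y) < 0)"
      unfolding rate_kinetic_energy[of Q, OF assms(1,2)]
      by (simp add: dist_norm norm_minus_commute[of m] not_le) (metis add_diff_cancel_left')
    then show ?thesis
      by (simp add: R_star_le_iff[OF \<open>R \<ge> 0\<close>])
  qed
  moreover have "trapping_region (vfield c L Q) (cball m R)" if ?decrease
  proof -
    have "(x - m) \<bullet> vfield c L Q x < 0" if "norm (x - m) > R" for x
      using \<open>?decrease\<close> that
      by (simp add: rate_kinetic_energy_eq_inner dist_norm norm_minus_commute[of m])
    then show ?thesis
      by (simp add: trapping_region_def forward_invariant_cball[OF \<open>R \<ge> 0\<close>])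
  qed
  ultimately show ?thesis
    unfolding mono_attracting_trapping_def by blast
qed

text \<open>Strict negativity of each value of the form would only bound \<open>a\<^sup>*\<close> by \<open>0\<close>; compactness of
  the unit sphere supplies the gap \<open>e\<close> that makes the infimum itself negative.\<close>

lemma a_star_neg_iff:
  assumes sym: "\<And>i. transpose (Q i) = Q i"
  shows "a_star L Q < 0 \<longleftrightarrow> (\<exists>m. A_s L Q m \<prec> 0)"
proof -
  have "a_star L Q < 0 \<longleftrightarrow> (\<exists>a<0. \<exists>m. A_s L Q m \<preceq> a *\<^sub>R mat 1)"
    by (auto simp: a_star_def INF_less_iff)
  also have "\<dots> \<longleftrightarrow> (\<exists>m. A_s L Q m \<prec> 0)"
  proof safe
    fix a m assume "a < 0" and le: "A_s L Q m \<preceq> a *\<^sub>R mat 1"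
    have "x \<bullet> (A_s L Q m *v x) < 0" if "x \<noteq> 0" for x
    proof -
      have "a * (x \<bullet> x) < 0"
        using \<open>a < 0\<close> that by (simp add: mult_neg_pos)
      then show ?thesis
        using le A_s_loewner_le_iff[of Q, OF sym] by (meson le_less_trans)
    qed
    then show "\<exists>m. A_s L Q m \<prec> 0"
      using A_s_negative_definite_iff[of Q, OF sym] by blast
  next
    fix m assume "A_s L Q m \<prec> 0"
    then obtain e where "e > 0" and "\<And>x. x \<bullet> (A_s L Q m *v x) \<le> - e * (x \<bullet> x)"
      using negative_form_uniform_bound[of "A_s L Q m"] A_s_negative_definite_iff[of Q, OF sym]
      by blast
    then have "- e < 0" "A_s L Q m \<preceq> (- e) *\<^sub>R mat 1"
      unfolding A_s_loewner_le_iff[of Q, OF sym] by auto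
    then show "\<exists>a<0. \<exists>m. A_s L Q m \<preceq> a *\<^sub>R mat 1"
      by blast
  qed
  finally show ?thesis .
qed

theorem theorem2:
  fixes c :: "real^'n" and L :: "real^'n^'n" and Q :: "'n \<Rightarrow> real^'n^'n"
  assumes Q_sym: "\<And>i. transpose (Q i) = Q i"
    and lossless: "lossless Q"
  shows
    "((\<exists>m. R_star c L Q m < \<infinity> \<and>
           mono_attracting_trapping (vfield c L Q) m (real_of_ereal (R_star c L Q m)))
        \<longleftrightarrow> a_star L Q < 0)
     \<and>
     (a_star L Q < 0 \<longrightarrow>
        (\<exists>m. A_s L Q m \<prec> 0) \<and>
        (\<forall>m. A_s L Q m \<prec> 0 \<longrightarrow>
           R_star c L Q m < \<infinity> \<and>
           mono_attracting_trapping (vfield c L Q) m (real_of_ereal (R_star c L Q m)) \<and>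
           (\<forall>R\<ge>0. mono_attracting_trapping (vfield c L Q) m R \<longrightarrow> R_star c L Q m \<le> ereal R)))"
proof -
  have attracting: "mono_attracting_trapping (vfield c L Q) m (real_of_ereal (R_star c L Q m))"
    if "R_star c L Q m < \<infinity>" for m
  proof -
    have "ereal (real_of_ereal (R_star c L Q m)) = R_star c L Q m"
      using that R_star_nonneg[of c L Q m] by (cases "R_star c L Q m") auto
    then show ?thesis
      using mono_attracting_trapping_iff_R_star_le[of Q, OF assms] R_star_nonneg[of c L Q m]
      by (simp add: real_of_ereal_pos)
  qed
  show ?thesis
    using attracting mono_attracting_trapping_iff_R_star_le[of Q, OF assms]
      R_star_finite_iff_negative_definite[of Q, OF Q_sym] a_star_neg_iff[of Q, OF Q_sym]
    by blast
qed

end
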